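(* Let $\mathbb{K}$ be $\mathbb{C}$ or $\mathbb{R}$. Let $X$ be a set of infinite cardinality $\kappa$, where $\kappa=\kappa^\omega$. Let $I$ be a subset of $\mathbb{K}$ with nonempty interior in $\mathbb{K}$. Let $\mathcal{F}$ be a family of subsets of $X$ such that $|\mathcal{F}|\leq\kappa$ and $|F|=\kappa$ for every $F\in\mathcal{F}$. Then the family $\mathcal{SES}(I,\mathcal{F})\subset\mathbb{K}^X$ is strongly $2^\kappa$-algebrable.
   Context: $\mathbb{K}^X$ is the commutative $\mathbb{K}$-algebra of all functions $X\to\mathbb{K}$ with pointwise operations. For $\mathcal{F}\subset\mathcal{P}(X)$ and $I\subset\mathbb{K}$, $\mathcal{SES}(I,\mathcal{F})$ (the $I$-strongly everywhere surjective functions with respect to $\mathcal{F}$) is the set of all $f\in\mathbb{K}^X$ such that for every $F\in\mathcal{F}$ there are $n\in\mathbb{N}$, $n\ge 1$, and a non-constant polynomial $P$ in $n$ variables over $\mathbb{K}$ with $f(F)=P(I^n)$, and moreover $|\{x\in F:f(x)=y\}|=|X|$ for every $y\in f(F)$. A subset $E$ of a commutative algebra $A$ is strongly $\lambda$-algebrable if $E\cup\{0\}$ contains a free algebra with $\lambda$ free generators; equivalently, there is $Y\subset E$ with $|Y|=\lambda$ such that for every $n\geq1$, every nonzero polynomial $P$ in $n$ variables without constant term and all distinct $y_1,\dots,y_n\in Y$ one has $P(y_1,\dots,y_n)\in E\setminus\{0\}$. *)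

theory Defs
  imports "HOL-Analysis.Analysis" "HOL-Library.FuncSet" "HOL-Library.Poly_Mapping"
begin

unbundle cardinal_syntax

text \<open>
  Multivariate polynomials are finitely supported maps from monomials to coefficients, a monomial
  being a finitely supported map from variable indices to exponents. The variables of a polynomial
  in \<open>n\<close> variables are numbered \<open>0, \<dots>, n - 1\<close>; the monomial \<open>0\<close> is that of the constant term.
\<close>

type_synonym 'k mpoly = "(nat \<Rightarrow>\<^sub>0 nat) \<Rightarrow>\<^sub>0 'k"

definition mpolys :: "nat \<Rightarrow> 'k::zero mpoly set" where
  "mpolys n = {P. \<forall>m\<in>Poly_Mapping.keys P. Poly_Mapping.keys m \<subseteq> {..<n}}"

definition nonconstant :: "'k::zero mpoly \<Rightarrow> bool" where
  "nonconstant P \<longleftrightarrow> (\<exists>m. m \<noteq> 0 \<and> Poly_Mapping.lookup P m \<noteq> 0)"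

definition mpoly_eval :: "'k::comm_semiring_1 mpoly \<Rightarrow> (nat \<Rightarrow> 'k) \<Rightarrow> 'k" where
  "mpoly_eval P v = (\<Sum>m\<in>Poly_Mapping.keys P. Poly_Mapping.lookup P m *
     (\<Prod>i\<in>Poly_Mapping.keys m. v i ^ Poly_Mapping.lookup m i))"

text \<open>
  The algebra \<open>\<KK>\<^sup>X\<close> is represented by the extensional functions \<open>X \<rightarrow>\<^sub>E UNIV\<close>. As its operations are
  pointwise, a polynomial \<open>P\<close> evaluated in it at \<open>y 0, \<dots>, y (n - 1)\<close> is the following function.
\<close>

definition fun_mpoly_eval :: "'x set \<Rightarrow> 'k::comm_semiring_1 mpoly \<Rightarrow> (nat \<Rightarrow> 'x \<Rightarrow> 'k) \<Rightarrow> 'x \<Rightarrow> 'k" where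
  "fun_mpoly_eval X P y = (\<lambda>x\<in>X. mpoly_eval P (\<lambda>i. y i x))"

definition SES :: "'x set \<Rightarrow> 'k::field set \<Rightarrow> 'x set set \<Rightarrow> ('x \<Rightarrow> 'k) set" where
  "SES X I \<F> = {f \<in> X \<rightarrow>\<^sub>E UNIV. \<forall>F\<in>\<F>.
     (\<exists>n\<ge>1. \<exists>P\<in>mpolys n. nonconstant P \<and> f ` F = mpoly_eval P ` ({..<n} \<rightarrow>\<^sub>E I)) \<and>
     (\<forall>y\<in>f ` F. |{x \<in> F. f x = y}| =o |X| )}"

text \<open>
  Strong algebrability of a subset \<open>E\<close> of \<open>\<KK>\<^sup>X\<close>: \<open>Y\<close> is a set of free generators of an algebra
  (not necessarily unital, hence the condition on the constant term) contained in \<open>E \<union> {0}\<close>.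
  The cardinal number \<open>r\<close> is given by a well-order.
\<close>

definition strongly_algebrable :: "'x set \<Rightarrow> ('x \<Rightarrow> 'k::field) set \<Rightarrow> 'r rel \<Rightarrow> bool" where
  "strongly_algebrable X E r \<longleftrightarrow> (\<exists>Y\<subseteq>E. |Y| =o r \<and>
     (\<forall>n\<ge>1. \<forall>P\<in>mpolys n. \<forall>y. P \<noteq> 0 \<and> Poly_Mapping.lookup P 0 = 0 \<and>
        inj_on y {..<n} \<and> y ` {..<n} \<subseteq> Y \<longrightarrow>
        fun_mpoly_eval X P y \<in> E - {\<lambda>x\<in>X. 0}))"

end

theory Submission
  imports Defs
begin

text \<open>
  As \<open>\<kappa> = \<kappa>\<^sup>\<omega> \<ge> 2\<^sup>\<omega>\<close>, the set \<open>I\<close> has at most \<open>\<kappa>\<close> elements, so Hausdorff's theorem gives \<open>2\<^sup>\<kappa>\<close>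
  functions \<open>X \<rightarrow> I\<close> such that any finitely many of them take any prescribed values in \<open>I\<close>
  at a common point. A transfinite choice plants \<open>\<kappa>\<close> copies of this family in every \<open>F \<in> \<F>\<close>, all of
  them disjoint; elsewhere all functions take one fixed value in \<open>I\<close>. For distinct functions
  \<open>h\<^sub>1, \<dots>, h\<^sub>n\<close> of the resulting family, \<open>P(h\<^sub>1, \<dots>, h\<^sub>n)\<close> maps each \<open>F\<close> onto \<open>P(I\<^sup>n)\<close> with fibres of
  size \<open>\<kappa>\<close>, and it is not zero because a nonzero polynomial does not vanish on \<open>I\<^sup>n\<close>.
\<close>

section \<open>Cardinal bounds and transfinite choice\<close>

lemma card_of_Times_ordLeq_infinite:
  assumes "infinite X" "|A| \<le>o |X|" "|B| \<le>o |X|"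
  shows "|A \<times> B| \<le>o |X|"
  using card_of_Sigma_ordLeq_infinite[OF assms(1,2), of "\<lambda>_. B"] assms(3) by blast

text \<open>Bounds the number of codes in Hausdorff's construction. The lists of each length are
  counted by induction, and there are countably many lengths.\<close>

lemma card_of_lists_ordLeq_infinite:
  assumes X: "infinite X" and A: "|A| \<le>o |X|"
  shows "|lists A| \<le>o |X|"
proof -
  have "|{xs \<in> lists A. length xs = n}| \<le>o |X|" for n
  proof (induction n)
    case 0
    have "{xs \<in> lists A. length xs = 0} = {[]}" by auto
    moreover have "X \<noteq> {}" using X by auto
    ultimately show ?case by (simp only: card_of_singl_ordLeq not_False_eq_True)
  next
    case (Suc n)
    let ?L = "{xs \<in> lists A. length xs = n}"
    have "{xs \<in> lists A. length xs = Suc n} \<subseteq> (\<lambda>(x, xs). x # xs) ` (A \<times> ?L)"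
      by (force simp: length_Suc_conv image_iff)
    then have "|{xs \<in> lists A. length xs = Suc n}| \<le>o |A \<times> ?L|"
      using card_of_image card_of_mono1 ordLeq_transitive by blast
    also have "|A \<times> ?L| \<le>o |X|"
      using X A Suc by (rule card_of_Times_ordLeq_infinite)
    finally show ?case .
  qed
  then have "|\<Union>n\<in>UNIV. {xs \<in> lists A. length xs = n}| \<le>o |X|"
    using X by (intro card_of_UNION_ordLeq_infinite) (auto simp: infinite_iff_card_of_nat)
  moreover have "(\<Union>n\<in>UNIV. {xs \<in> lists A. length xs = n}) = lists A" by auto
  ultimately show ?thesis by simp
qed

text \<open>Recursion along the well-order \<open>|J|\<close>: each proper initial segment has
  cardinality less than \<open>|J|\<close>, so the values chosen earlier cannot exhaust
  \<open>S j\<close>.\<close>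

lemma injective_choice:
  fixes S :: "'j \<Rightarrow> 'x set"
  assumes "\<And>j. j \<in> J \<Longrightarrow> |J| \<le>o |S j|"
  shows "\<exists>c. inj_on c J \<and> (\<forall>j\<in>J. c j \<in> S j)"
proof -
  let ?r = "|J| - Id"
  have wo: "well_order_on J |J|" by (rule card_of_well_order_on)
  have "\<exists>c. \<forall>j. j \<in> J \<longrightarrow> c j \<in> S j - c ` underS |J| j"
  proof (rule dependent_wf_choice)
    show "wf ?r" using wo by (simp add: well_order_on_def)
  next
    fix f g :: "'j \<Rightarrow> 'x" and x r assume "\<And>z. (z, x) \<in> ?r \<Longrightarrow> f z = g z"
    then have "f ` underS |J| x = g ` underS |J| x"
      by (intro image_cong) (auto simp: underS_def)
    then show "(x \<in> J \<longrightarrow> r \<in> S x - f ` underS |J| x) = (x \<in> J \<longrightarrow> r \<in> S x - g ` underS |J| x)"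
      by simp
  next
    fix x and f :: "'j \<Rightarrow> 'x"
    show "\<exists>r. x \<in> J \<longrightarrow> r \<in> S x - f ` underS |J| x"
    proof (cases "x \<in> J")
      case True
      have "|f ` underS |J| x| \<le>o |underS |J| x|" by (rule card_of_image)
      also have "|underS |J| x| <o |J|"
        using True by (intro card_of_underS) (simp_all add: Field_card_of card_of_card_order_on)
      also have "|J| \<le>o |S x|" using assms True .
      finally have "\<not> S x \<subseteq> f ` underS |J| x"
        using card_of_mono1 not_ordLess_ordLeq by blast
      then show ?thesis by auto
    qed auto
  qed
  then obtain c where c: "\<And>j. j \<in> J \<Longrightarrow> c j \<in> S j - c ` underS |J| j" by blast
  have "inj_on c J"
  proof (rule inj_onI, rule ccontr)
    fix i j assume ij: "i \<in> J" "j \<in> J" "c i = c j" "i \<noteq> j"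
    have "(i, j) \<in> |J| \<or> (j, i) \<in> |J|"
      using wo ij unfolding well_order_on_def linear_order_on_def total_on_def by blast
    then show False using ij c[of i] c[of j] by (auto simp: underS_def image_iff)
  qed
  with c show ?thesis by blast
qed

section \<open>Hausdorff's independent functions\<close>

text \<open>
  Hausdorff's construction: a code is a finite set \<open>s\<close> together with a finite table assigning
  values to subsets of \<open>s\<close>, and the function indexed by \<open>B\<close> looks up \<open>B \<inter> s\<close> in that table.
\<close>

lemma independent_functions:
  fixes X :: "'x set" and I :: "'k set"
  assumes X: "infinite X" and I: "|I| \<le>o |X|" "I \<noteq> {}"
  obtains f :: "'x set \<Rightarrow> 'x \<Rightarrow> 'k"
  where "\<And>B x. f B x \<in> I"
    and "\<And>n B t. inj_on B {..<n} \<Longrightarrow> B ` {..<n} \<subseteq> Pow X \<Longrightarrow> t ` {..<n} \<subseteq> I \<Longrightarrow>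
           \<exists>x\<in>X. \<forall>i<(n::nat). f (B i) x = t i"
proof -
  obtain a where a: "a \<in> I" using I by auto
  \<comment> \<open>Lists stand for the finite sets and the finite tables of a code;
    \<open>apfst set\<close> below turns the keys of a table back into sets.\<close>
  define D where "D = lists X \<times> lists (lists X \<times> I)"
  \<comment> \<open>The test \<open>v \<in> I\<close> is there because \<open>inv_into D e x\<close>
    is an arbitrary code when \<open>x\<close> lies outside the range of \<open>e\<close>; the
    values must stay in \<open>I\<close> even then.\<close>
  define g where "g = (\<lambda>(B :: 'x set) (s, L). case map_of (map (apfst set) L) (B \<inter> set s) of
      None \<Rightarrow> a | Some v \<Rightarrow> if v \<in> I then v else a)"
  have "|D| \<le>o |X|" unfolding D_def
    using X I(1) ordLeq_refl[OF card_of_Card_order[of X]]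
    by (intro card_of_Times_ordLeq_infinite card_of_lists_ordLeq_infinite)
  then obtain e where e: "inj_on e D" "e ` D \<subseteq> X" by (auto simp flip: card_of_ordLeq)
  show ?thesis
  proof
    show "g B (inv_into D e x) \<in> I" for B x
      using a by (auto simp: g_def split: prod.split option.split)
    fix n :: nat and B :: "nat \<Rightarrow> 'x set" and t :: "nat \<Rightarrow> 'k"
    assume B: "inj_on B {..<n}" "B ` {..<n} \<subseteq> Pow X" and t: "t ` {..<n} \<subseteq> I"
    \<comment> \<open>\<open>p i j\<close> is a point telling \<open>B i\<close> from
      \<open>B j\<close>. Collecting these points in \<open>s\<close> gives the finitely many sets
      pairwise distinct traces on \<open>set s\<close>, which can then serve as keys.\<close>
    define p where "p i j = (SOME x. x \<in> B i - B j \<union> (B j - B i))" for i j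
    have p: "p i j \<in> B i - B j \<union> (B j - B i)" if "i < n" "j < n" "i \<noteq> j" for i j
    proof -
      have "B i \<noteq> B j" using B(1) that by (auto simp: inj_on_def)
      then have "\<exists>x. x \<in> B i - B j \<union> (B j - B i)" by auto
      then show ?thesis unfolding p_def by (rule someI_ex)
    qed
    define N where "N = {(i, j). i < n \<and> j < n \<and> i \<noteq> j}"
    have "finite N" by (rule finite_subset[of _ "{..<n} \<times> {..<n}"]) (auto simp: N_def)
    then obtain s where s: "set s = case_prod p ` N"
      using finite_list[of "case_prod p ` N"] by auto
    have "p i j \<in> X" if "i < n" "j < n" "i \<noteq> j" for i j
      using p[OF that] B(2) that by auto
    then have sX: "set s \<subseteq> X" by (auto simp: s N_def)
    have "\<exists>l. set l = B i \<inter> set s" for i by (rule finite_list) simp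
    then obtain l where l: "\<And>i. set (l i) = B i \<inter> set s" by metis
    define L where "L = map (\<lambda>i. (l i, t i)) [0..<n]"
    have inj: "inj_on (\<lambda>i. B i \<inter> set s) {..<n}"
    proof (rule inj_onI, rule ccontr)
      fix i j assume ij: "i \<in> {..<n}" "j \<in> {..<n}" "B i \<inter> set s = B j \<inter> set s" "i \<noteq> j"
      then have "p i j \<in> set s" by (force simp: s N_def)
      then show False using p[of i j] ij by auto
    qed
    have lookup: "map_of (map (apfst set) L) (B i \<inter> set s) = Some (t i)" if "i < n" for i
    proof (rule map_of_is_SomeI)
      have "map fst (map (apfst set) L) = map (\<lambda>i. B i \<inter> set s) [0..<n]"
        by (simp add: L_def l)
      then show "distinct (map fst (map (apfst set) L))"
        using inj by (simp add: distinct_map atLeast0LessThan)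
      show "(B i \<inter> set s, t i) \<in> set (map (apfst set) L)"
        using that by (auto simp: L_def l image_iff)
    qed
    have "(s, L) \<in> D" using sX t by (auto simp: D_def L_def l image_subset_iff subset_iff)
    moreover have "g (B i) (s, L) = t i" if "i < n" for i
      using lookup[OF that] t that by (auto simp: g_def)
    ultimately show "\<exists>x\<in>X. \<forall>i<n. g (B i) (inv_into D e x) = t i"
      using e by (intro bexI[of _ "e (s, L)"]) auto
  qed
qed

section \<open>Polynomials vanishing on powers of an infinite set\<close>

lemma power_sum_eq_0_imp_coeffs_eq_0:
  fixes a :: "nat \<Rightarrow> 'k::idom"
  assumes "infinite I" "finite K" "\<And>x. x \<in> I \<Longrightarrow> (\<Sum>k\<in>K. a k * x ^ k) = 0" "k \<in> K"
  shows "a k = 0"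
proof -
  define p where "p = (\<Sum>k\<in>K. monom (a k) k)"
  have "I \<subseteq> {x. poly p x = 0}"
    using assms(3) by (auto simp: p_def poly_sum poly_monom)
  then have "p = 0" using assms(1) poly_roots_finite finite_subset by blast
  moreover have "coeff p k = a k"
    using assms(2,4) by (simp add: p_def coeff_sum coeff_monom sum.delta)
  ultimately show ?thesis by simp
qed

text \<open>Induction on the number of variables. Grouping the terms by the exponent of the last
  variable gives, for fixed values of the others, a univariate polynomial with infinitely many
  roots, so each group vanishes by itself. Arbitrary indices \<open>m\<close> with exponents
  \<open>e m\<close> let the induction pass to a group without changing its monomials.\<close>

lemma monomial_sum_eq_0_imp_coeffs_eq_0:
  fixes c :: "'m \<Rightarrow> 'k::idom" and e :: "'m \<Rightarrow> nat \<Rightarrow> nat"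
  assumes "infinite I" "finite M"
    and "\<And>m m'. m \<in> M \<Longrightarrow> m' \<in> M \<Longrightarrow> (\<forall>i<n. e m i = e m' i) \<Longrightarrow> m = m'"
    and "\<And>v. v ` {..<n} \<subseteq> I \<Longrightarrow> (\<Sum>m\<in>M. c m * (\<Prod>i<n. v i ^ e m i)) = 0"
    and "m \<in> M"
  shows "c m = 0"
  using assms(2-)
proof (induction n arbitrary: M m)
  case 0
  then have "M = {m}" by auto
  then show ?case using 0(3)[of undefined] by simp
next
  case (Suc n)
  define M' where "M' k = {m \<in> M. e m n = k}" for k
  have zero: "(\<Sum>m\<in>M' k. c m * (\<Prod>i<n. v i ^ e m i)) = 0"
    if v: "v ` {..<n} \<subseteq> I" and k: "k \<in> (\<lambda>m. e m n) ` M" for v k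
  proof (rule power_sum_eq_0_imp_coeffs_eq_0[OF assms(1) _ _ k])
    show "finite ((\<lambda>m. e m n) ` M)" using Suc.prems(1) by simp
    fix x assume x: "x \<in> I"
    have "(\<Sum>k\<in>(\<lambda>m. e m n) ` M. (\<Sum>m\<in>M' k. c m * (\<Prod>i<n. v i ^ e m i)) * x ^ k) =
        (\<Sum>k\<in>(\<lambda>m. e m n) ` M. \<Sum>m\<in>M' k. c m * (\<Prod>i<n. v i ^ e m i) * x ^ e m n)"
      by (simp add: sum_distrib_right M'_def)
    also have "\<dots> = (\<Sum>m\<in>M. c m * (\<Prod>i<n. v i ^ e m i) * x ^ e m n)"
      unfolding M'_def using Suc.prems(1) by (intro sum.group) auto
    also have "\<dots> = (\<Sum>m\<in>M. c m * (\<Prod>i<Suc n. (v(n := x)) i ^ e m i))"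
      by (simp add: mult.assoc)
    also have "\<dots> = 0" using v x by (intro Suc.prems(3)) (auto simp: less_Suc_eq)
    finally show "(\<Sum>k\<in>(\<lambda>m. e m n) ` M. (\<Sum>m\<in>M' k. c m * (\<Prod>i<n. v i ^ e m i)) * x ^ k) = 0" .
  qed
  show ?case
  \<comment> \<open>Within the group of \<open>m\<close> the last exponent is constant, so the first
    \<open>n\<close> exponents already separate its members.\<close>
  proof (rule Suc.IH[of "M' (e m n)"])
    show "finite (M' (e m n))" using Suc.prems(1) by (simp add: M'_def)
    show "m \<in> M' (e m n)" using Suc.prems(4) by (simp add: M'_def)
    show "m1 = m2" if "m1 \<in> M' (e m n)" "m2 \<in> M' (e m n)" "\<forall>i<n. e m1 i = e m2 i" for m1 m2
      using that by (intro Suc.prems(2)) (auto simp: M'_def less_Suc_eq)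
  qed (use zero Suc.prems(4) in auto)
qed

text \<open>Variables absent from a monomial contribute a factor \<open>1\<close>, so all products
  can run over the same range.\<close>

lemma mpoly_eval_eq_prod_lessThan:
  fixes P :: "'k::comm_semiring_1 mpoly"
  assumes "P \<in> mpolys n"
  shows "mpoly_eval P v = (\<Sum>m\<in>Poly_Mapping.keys P. Poly_Mapping.lookup P m *
     (\<Prod>i<n. v i ^ Poly_Mapping.lookup m i))"
  unfolding mpoly_eval_def
proof (rule sum.cong[OF refl])
  fix m assume "m \<in> Poly_Mapping.keys P"
  then have "Poly_Mapping.keys m \<subseteq> {..<n}" using assms by (auto simp: mpolys_def)
  then have "(\<Prod>i\<in>Poly_Mapping.keys m. v i ^ Poly_Mapping.lookup m i) =
      (\<Prod>i<n. v i ^ Poly_Mapping.lookup m i)"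
    by (intro prod.mono_neutral_left) (auto simp: in_keys_iff)
  then show "Poly_Mapping.lookup P m * (\<Prod>i\<in>Poly_Mapping.keys m. v i ^ Poly_Mapping.lookup m i) =
      Poly_Mapping.lookup P m * (\<Prod>i<n. v i ^ Poly_Mapping.lookup m i)" by simp
qed

lemma mpoly_eval_cong:
  assumes "P \<in> mpolys n" "\<And>i. i < n \<Longrightarrow> v i = w i"
  shows "mpoly_eval P v = mpoly_eval P w"
  using assms(2) by (simp add: mpoly_eval_eq_prod_lessThan[OF assms(1)])

lemma mpoly_eval_nonzero_on:
  fixes P :: "'k::idom mpoly"
  assumes "infinite I" "P \<in> mpolys n" "P \<noteq> 0"
  obtains v where "v ` {..<n} \<subseteq> I" "mpoly_eval P v \<noteq> 0"
proof (rule ccontr)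
  assume "\<not> thesis"
  with that have z: "mpoly_eval P v = 0" if "v ` {..<n} \<subseteq> I" for v using \<open>v ` {..<n} \<subseteq> I\<close> by blast
  have "Poly_Mapping.lookup P m = 0" if "m \<in> Poly_Mapping.keys P" for m
  proof (rule monomial_sum_eq_0_imp_coeffs_eq_0[OF assms(1) _ _ _ that])
    show "m1 = m2" if m: "m1 \<in> Poly_Mapping.keys P" "m2 \<in> Poly_Mapping.keys P"
      and eq: "\<forall>i<n. Poly_Mapping.lookup m1 i = Poly_Mapping.lookup m2 i" for m1 m2
    proof (rule poly_mapping_eqI)
      fix i
      have "Poly_Mapping.keys m1 \<subseteq> {..<n}" "Poly_Mapping.keys m2 \<subseteq> {..<n}"
        using m assms(2) by (auto simp: mpolys_def)
      then have "i < n" if "Poly_Mapping.lookup m1 i \<noteq> 0 \<or> Poly_Mapping.lookup m2 i \<noteq> 0"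
        using that unfolding in_keys_iff[symmetric] by auto
      then show "Poly_Mapping.lookup m1 i = Poly_Mapping.lookup m2 i" using eq by metis
    qed
  qed (use z mpoly_eval_eq_prod_lessThan[OF assms(2)] in auto)
  then have "Poly_Mapping.keys P = {}" by (meson ex_in_conv in_keys_iff)
  then show False using assms(3) by simp
qed

section \<open>The free generators\<close>

text \<open>Isolates what the argument uses of \<open>I\<close>: it is infinite and has at most
  \<open>|X|\<close> elements. The generators are the functions \<open>h B\<close> for
  \<open>B \<subseteq> X\<close>.\<close>

lemma strongly_algebrable_SES:
  fixes X :: "'x set" and \<F> :: "'x set set" and I :: "'k::field set"
  assumes X: "infinite X" and sub: "\<F> \<subseteq> Pow X" and card: "|\<F>| \<le>o |X|"
    and F: "\<And>F. F \<in> \<F> \<Longrightarrow> |F| =o |X|"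
    and I: "infinite I" "|I| \<le>o |X|"
  shows "strongly_algebrable X (SES X I \<F>) (ctwo ^c |X| )"
proof -
  obtain a where a: "a \<in> I" using I by fastforce
  obtain f :: "'x set \<Rightarrow> 'x \<Rightarrow> 'k" where f: "\<And>B x. f B x \<in> I"
    and ind: "\<And>n B t. inj_on B {..<n} \<Longrightarrow> B ` {..<n} \<subseteq> Pow X \<Longrightarrow> t ` {..<n} \<subseteq> I \<Longrightarrow>
           \<exists>x\<in>X. \<forall>i<(n::nat). f (B i) x = t i"
    using independent_functions[OF X I(2)] a by (metis empty_iff)
  \<comment> \<open>Adding \<open>X\<close> makes the evaluated polynomials nonzero even when \<open>\<F>\<close> is empty.\<close>
  define \<G> where "\<G> = insert X \<F>"
  have G: "G \<subseteq> X" "|G| =o |X|" if "G \<in> \<G>" for G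
    using that sub F card_of_refl by (auto simp: \<G>_def)
  have "X \<noteq> {}" using X by auto
  then have "|{X} \<union> \<F>| \<le>o |X|" using X card
    by (intro card_of_Un_ordLeq_infinite_Field card_of_Card_order)
      (simp_all add: Field_card_of card_of_singl_ordLeq)
  then have J: "|\<G> \<times> X \<times> X| \<le>o |X|"
    using card_of_Card_order ordLeq_refl
    by (intro card_of_Times_ordLeq_infinite[OF X]) (auto simp: \<G>_def)
  have "|\<G> \<times> X \<times> X| \<le>o |fst j|" if "j \<in> \<G> \<times> X \<times> X" for j
    using J G(2)[of "fst j"] that by (metis mem_Times_iff ordIso_symmetric ordLeq_ordIso_trans)
  \<comment> \<open>\<open>c (G, x, z)\<close> is the copy number \<open>z\<close> of the point
    \<open>x\<close>, placed inside \<open>G\<close>. Injectivity keeps all copies apart, even when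
    members of \<open>\<G>\<close> overlap.\<close>
  then obtain c :: "_ \<Rightarrow> 'x" where c: "inj_on c (\<G> \<times> X \<times> X)" "\<And>j. j \<in> \<G> \<times> X \<times> X \<Longrightarrow> c j \<in> fst j"
    using injective_choice[of "\<G> \<times> X \<times> X" fst] by blast
  \<comment> \<open>At a copy of \<open>x\<close> the function \<open>h B\<close> repeats
    \<open>f B x\<close>. The default \<open>a\<close> lies in \<open>I\<close>, so points that are
    not copies add no values outside \<open>P(I^n)\<close>.\<close>
  define h where "h B = (\<lambda>x\<in>X. if x \<in> c ` (\<G> \<times> X \<times> X)
      then f B (fst (snd (inv_into (\<G> \<times> X \<times> X) c x))) else a)" for B
  have hI: "h B x \<in> I" if "x \<in> X" for B x using f a that by (simp add: h_def)
  have hc: "h B (c (G, x, z)) = f B x" if "G \<in> \<G>" "x \<in> X" "z \<in> X" for B G x z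
  proof -
    have "c (G, x, z) \<in> X" using c(2)[of "(G, x, z)"] that G(1) by auto
    then show ?thesis using c(1) that by (auto simp: h_def)
  qed
  have many: "|X| \<le>o |{x \<in> G. \<forall>i<n. h (B i) x = t i}|"
    if B: "inj_on B {..<n}" "B ` {..<n} \<subseteq> Pow X" and t: "t ` {..<n} \<subseteq> I" and "G \<in> \<G>"
    for n :: nat and B t G
  proof -
    \<comment> \<open>One point realising \<open>t\<close> suffices: its copies in \<open>G\<close>,
      indexed by \<open>z\<close>, number \<open>|X|\<close>.\<close>
    obtain x where x: "x \<in> X" "\<forall>i<n. f (B i) x = t i" using ind[OF B t] by blast
    show ?thesis
    proof (rule card_of_ordLeqI[of "\<lambda>z. c (G, x, z)"])
      show "inj_on (\<lambda>z. c (G, x, z)) X"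
        using c(1) x \<open>G \<in> \<G>\<close> by (auto simp: inj_on_def)
      show "c (G, x, z) \<in> {x \<in> G. \<forall>i<n. h (B i) x = t i}" if "z \<in> X" for z
        using c(2)[of "(G, x, z)"] hc x \<open>z \<in> X\<close> \<open>G \<in> \<G>\<close> by auto
    qed
  qed
  have main: "fun_mpoly_eval X P (\<lambda>i. h (B i)) \<in> SES X I \<F> - {\<lambda>x\<in>X. 0}"
    if n: "n \<ge> 1" and P: "P \<in> mpolys n" "P \<noteq> 0" "Poly_Mapping.lookup P 0 = 0"
      and B: "inj_on B {..<n}" "B ` {..<n} \<subseteq> Pow X" for n P B
  proof -
    let ?g = "fun_mpoly_eval X P (\<lambda>i. h (B i))"
    have fib: "|X| \<le>o |{x \<in> G. ?g x = mpoly_eval P t}|"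
      if "G \<in> \<G>" "t ` {..<n} \<subseteq> I" for G t
    proof -
      have "{x \<in> G. \<forall>i<n. h (B i) x = t i} \<subseteq> {x \<in> G. ?g x = mpoly_eval P t}"
        using G(1)[OF that(1)] by (auto simp: fun_mpoly_eval_def intro!: mpoly_eval_cong[OF P(1)])
      then show ?thesis
        using many[OF B that(2,1)] card_of_mono1 ordLeq_transitive by blast
    qed
    have ex: "\<exists>x\<in>G. ?g x = mpoly_eval P t" if "G \<in> \<G>" "t ` {..<n} \<subseteq> I" for G t
    proof -
      have "infinite {x \<in> G. ?g x = mpoly_eval P t}"
        using fib[OF that] X card_of_ordLeq_finite by blast
      then show ?thesis using infinite_imp_nonempty by blast
    qed
    \<comment> \<open>A nonzero polynomial without constant term must have a nonzero coefficient at
      some other monomial.\<close>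
    have nonconst: "nonconstant P"
      using P(2,3) unfolding nonconstant_def by (metis poly_mapping_eqI lookup_zero)
    have img: "?g ` G = mpoly_eval P ` ({..<n} \<rightarrow>\<^sub>E I)" if "G \<in> \<G>" for G
    proof (intro equalityI subsetI)
      fix y assume "y \<in> ?g ` G"
      then obtain x where x: "x \<in> G" "y = ?g x" by blast
      then have "x \<in> X" using G(1)[OF that] by auto
      then have "y = mpoly_eval P (\<lambda>i. h (B i) x)" using x by (simp add: fun_mpoly_eval_def)
      also have "\<dots> = mpoly_eval P (\<lambda>i\<in>{..<n}. h (B i) x)" by (rule mpoly_eval_cong[OF P(1)]) simp
      finally show "y \<in> mpoly_eval P ` ({..<n} \<rightarrow>\<^sub>E I)" using hI[OF \<open>x \<in> X\<close>] by auto
    next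
      fix y assume "y \<in> mpoly_eval P ` ({..<n} \<rightarrow>\<^sub>E I)"
      then obtain t where "t \<in> {..<n} \<rightarrow>\<^sub>E I" "y = mpoly_eval P t" by blast
      moreover from this have "\<exists>x\<in>G. ?g x = mpoly_eval P t" by (intro ex that) auto
      ultimately show "y \<in> ?g ` G" by force
    qed
    have "|{x \<in> G. ?g x = y}| =o |X|" if "G \<in> \<G>" and y: "y \<in> ?g ` G" for G y
    proof -
      obtain t where t: "t \<in> {..<n} \<rightarrow>\<^sub>E I" "y = mpoly_eval P t" using y img[OF \<open>G \<in> \<G>\<close>] by blast
      then have "|X| \<le>o |{x \<in> G. ?g x = y}|" using fib[OF that(1), of t] by auto
      moreover have "|{x \<in> G. ?g x = y}| \<le>o |X|"
        using G(1)[OF that(1)] by (intro card_of_mono1) auto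
      ultimately show ?thesis by (simp add: ordIso_iff_ordLeq)
    qed
    then have "?g \<in> SES X I \<F>"
      unfolding SES_def using n P(1) nonconst img
      by (auto simp: fun_mpoly_eval_def \<G>_def)
    moreover have "?g \<noteq> (\<lambda>x\<in>X. 0)"
    proof -
      obtain t where "t ` {..<n} \<subseteq> I" "mpoly_eval P t \<noteq> 0"
        using mpoly_eval_nonzero_on[OF I(1) P(1,2)] .
      then obtain x where "x \<in> X" "?g x \<noteq> 0" using ex[of X t] by (auto simp: \<G>_def)
      then show ?thesis by (metis restrict_apply')
    qed
    ultimately show ?thesis by simp
  qed
  have inj: "inj_on h (Pow X)"
  proof (rule inj_onI, rule ccontr)
    fix A B assume AB: "A \<in> Pow X" "B \<in> Pow X" "h A = h B" "A \<noteq> B"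
    \<comment> \<open>Independence, applied to \<open>A\<close> and \<open>B\<close> with two
      different target values \<open>a\<close> and \<open>b\<close>, separates \<open>h A\<close>
      from \<open>h B\<close>.\<close>
    obtain b where b: "b \<in> I" "b \<noteq> a"
      using I(1) by (metis finite.simps infinite_imp_nonempty insertI1 singletonI subsetI finite_subset)
    let ?B = "\<lambda>i::nat. if i = 0 then A else B" and ?t = "\<lambda>i::nat. if i = 0 then a else b"
    have "|X| \<le>o |{x \<in> X. \<forall>i<2. h (?B i) x = ?t i}|"
      by (rule many) (use AB a b in \<open>auto simp: inj_on_def \<G>_def\<close>)
    then have "infinite {x \<in> X. \<forall>i<2. h (?B i) x = ?t i}"
      using X card_of_ordLeq_finite by blast
    then obtain x where "\<forall>i<2. h (?B i) x = ?t i" using infinite_imp_nonempty by blast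
    then have "h (?B 0) x = ?t 0" "h (?B 1) x = ?t 1"
      by (metis pos2, metis one_less_numeral_iff semiring_norm(76))
    then have "h A x = a" "h B x = b" by simp_all
    then show False using AB b by simp
  qed
  show ?thesis unfolding strongly_algebrable_def
  proof (intro exI[of _ "h ` Pow X"] conjI allI ballI impI)
    show "h ` Pow X \<subseteq> SES X I \<F>"
    proof
      fix y assume "y \<in> h ` Pow X"
      then obtain B where B: "B \<subseteq> X" "y = h B" by auto
      \<comment> \<open>\<open>P\<close> is the polynomial consisting of the single variable number
        \<open>0\<close>; evaluating it at \<open>h B\<close> returns \<open>h B\<close>, so the
        generators themselves fall under \<open>main\<close>.\<close>
      define v :: "nat \<Rightarrow>\<^sub>0 nat" where "v = Poly_Mapping.single 0 1"
      define P :: "'k mpoly" where "P = Poly_Mapping.single v 1"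
      have "v \<noteq> 0" unfolding v_def by (metis lookup_single_eq lookup_zero zero_neq_one)
      moreover have "P \<noteq> 0" unfolding P_def by (metis lookup_single_eq lookup_zero zero_neq_one)
      ultimately have "fun_mpoly_eval X P (\<lambda>_. h B) \<in> SES X I \<F> - {\<lambda>x\<in>X. 0}"
        using B by (intro main[of 1 P "\<lambda>_. B"])
          (auto simp: P_def v_def mpolys_def lookup_single inj_on_def)
      moreover have "fun_mpoly_eval X P (\<lambda>_. h B) = h B"
        by (auto simp: fun_mpoly_eval_def P_def v_def mpoly_eval_def h_def fun_eq_iff)
      ultimately show "y \<in> SES X I \<F>" using B by simp
    qed
    have "|h ` Pow X| =o |Pow X|"
      using inj card_of_ordIso bij_betw_imageI ordIso_symmetric by blast
    then show "|h ` Pow X| =o ctwo ^c |X|"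
      using card_of_Pow_Func[of X] ordIso_transitive
      by (auto simp: cexp_def ctwo_def Field_card_of)
  next
    fix n :: nat and P :: "'k mpoly" and y
    assume n: "1 \<le> n" and P: "P \<in> mpolys n"
      and "P \<noteq> 0 \<and> Poly_Mapping.lookup P 0 = 0 \<and> inj_on y {..<n} \<and> y ` {..<n} \<subseteq> h ` Pow X"
    then have *: "P \<noteq> 0" "Poly_Mapping.lookup P 0 = 0" "inj_on y {..<n}" "y ` {..<n} \<subseteq> h ` Pow X"
      by auto
    define B where "B = inv_into (Pow X) h \<circ> y"
    have hB: "h (B i) = y i" "B i \<in> Pow X" if "i < n" for i
      using *(4) that by (auto simp: B_def intro!: f_inv_into_f inv_into_into[of _ h "Pow X", simplified])
    have "inj_on B {..<n}" using hB *(3) unfolding inj_on_def by (metis lessThan_iff)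
    moreover have "fun_mpoly_eval X P y = fun_mpoly_eval X P (\<lambda>i. h (B i))"
      unfolding fun_mpoly_eval_def using hB
      by (intro restrict_ext mpoly_eval_cong[OF P]) auto
    ultimately show "fun_mpoly_eval X P y \<in> SES X I \<F> - {\<lambda>x\<in>X. 0}"
      using main[OF n P *(1,2), of B] hB by auto
  qed
qed

section \<open>The real and complex cases\<close>

text \<open>The continuum is \<open>2^\<omega>\<close>, which is at most
  \<open>\<kappa>^\<omega> = \<kappa>\<close>.\<close>

lemma card_of_real_ordLeq:
  assumes "infinite X" "|X| =o |X| ^c natLeq"
  shows "|UNIV :: real set| \<le>o |X|"
proof -
  have "|UNIV :: real set| =o |Pow (UNIV :: nat set)|"
    using nat_sets_eqpoll_reals
    by (simp add: eqpoll_iff_card_of_ordIso ordIso_symmetric)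
  also have "|Pow (UNIV :: nat set)| =o ctwo ^c natLeq"
    using card_of_Pow_Func[of "UNIV :: nat set"]
    by (simp add: cexp_def ctwo_def Field_card_of Field_natLeq)
  also have "ctwo ^c natLeq \<le>o |X| ^c natLeq"
    using assms(1)
    by (intro cexp_mono1 ctwo_ordLeq_Cinfinite)
      (simp_all add: cinfinite_def Field_card_of natLeq_Card_order card_of_card_order_on)
  also have "|X| ^c natLeq =o |X|" using assms(2) by (rule ordIso_symmetric)
  finally show ?thesis .
qed

lemma card_of_complex_ordLeq:
  assumes "infinite X" "|X| =o |X| ^c natLeq"
  shows "|UNIV :: complex set| \<le>o |X|"
proof -
  have "inj_on (\<lambda>z. (Re z, Im z)) UNIV" by (auto simp: inj_on_def complex_eq_iff)
  then have "|UNIV :: complex set| \<le>o |(UNIV :: real set) \<times> (UNIV :: real set)|"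
    by (rule card_of_ordLeqI) auto
  also have "|(UNIV :: real set) \<times> (UNIV :: real set)| \<le>o |X|"
    using assms(1) card_of_real_ordLeq[OF assms] card_of_real_ordLeq[OF assms]
    by (rule card_of_Times_ordLeq_infinite)
  finally show ?thesis .
qed

theorem theorem2p2:
  fixes X :: "'x set" and \<F> :: "'x set set"
  assumes "infinite X"
    and "|X| =o |X| ^c natLeq"
    and "\<F> \<subseteq> Pow X"
    and "|\<F>| \<le>o |X|"
    and "\<And>F. F \<in> \<F> \<Longrightarrow> |F| =o |X|"
  shows "(\<forall>I :: real set. interior I \<noteq> {} \<longrightarrow>
            strongly_algebrable X (SES X I \<F>) (ctwo ^c |X| )) \<and>
         (\<forall>I :: complex set. interior I \<noteq> {} \<longrightarrow>
            strongly_algebrable X (SES X I \<F>) (ctwo ^c |X| ))"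
proof (intro conjI allI impI)
  fix I :: "real set" assume "interior I \<noteq> {}"
  \<comment> \<open>Finite sets have empty interior, so \<open>I\<close> is infinite; as a subset of
    the field it has at most \<open>|X|\<close> elements.\<close>
  then show "strongly_algebrable X (SES X I \<F>) (ctwo ^c |X| )"
    using empty_interior_finite assms(1,3-)
      ordLeq_transitive[OF card_of_mono1[OF subset_UNIV] card_of_real_ordLeq[OF assms(1,2)]]
    by (intro strongly_algebrable_SES) blast+
next
  fix I :: "complex set" assume "interior I \<noteq> {}"
  then show "strongly_algebrable X (SES X I \<F>) (ctwo ^c |X| )"
    using empty_interior_finite assms(1,3-)
      ordLeq_transitive[OF card_of_mono1[OF subset_UNIV] card_of_complex_ordLeq[OF assms(1,2)]]
    by (intro strongly_algebrable_SES) blast+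
qed

end
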